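(* For every integer $n\ge 11$, the graph $P(n,3)$ has no edge resolving set consisting of exactly $3$ vertices.
   Context: For integers $n\ge 3$ and $1\le k<n/2$, the generalized Petersen graph $P(n,k)$ is the graph with vertex set $\{u_j,v_j : j\in\mathbb{Z}_n\}$ and edge set $\{u_ju_{j+1},\,v_jv_{j+k},\,u_jv_j : j\in\mathbb{Z}_n\}$, indices taken modulo $n$. In a connected graph $G$, the distance between a vertex $x$ and an edge $e=yz$ is $d(x,e)=\min\{d(x,y),d(x,z)\}$, where $d(\cdot,\cdot)$ is the usual graph distance. A set $R$ of vertices is an edge resolving set of $G$ if for every two distinct edges $e,e'$ of $G$ there is $x\in R$ with $d(x,e)\ne d(x,e')$. *)

theory Defs
  imports Main
begin

text \<open>
  A simple graph is a pair of a vertex set and a set of edges, each edge being a two-element set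
  of vertices.
\<close>

type_synonym 'a graph = "'a set \<times> 'a set set"

definition verts :: "'a graph \<Rightarrow> 'a set" where
  "verts G = fst G"

definition edges :: "'a graph \<Rightarrow> 'a set set" where
  "edges G = snd G"

definition walk :: "'a graph \<Rightarrow> 'a \<Rightarrow> 'a list \<Rightarrow> 'a \<Rightarrow> bool" where
  "walk G x p y \<longleftrightarrow> p \<noteq> [] \<and> set p \<subseteq> verts G \<and> hd p = x \<and> last p = y \<and>
     (\<forall>i. Suc i < length p \<longrightarrow> {p ! i, p ! Suc i} \<in> edges G)"

definition connected_graph :: "'a graph \<Rightarrow> bool" where
  "connected_graph G \<longleftrightarrow> verts G \<noteq> {} \<and> (\<forall>x\<in>verts G. \<forall>y\<in>verts G. \<exists>p. walk G x p y)"

text \<open>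
  The length of a walk counts its edges. The distance is meaningful only for vertices joined by
  a walk; it is used here only for connected graphs.
\<close>

definition graph_dist :: "'a graph \<Rightarrow> 'a \<Rightarrow> 'a \<Rightarrow> nat" where
  "graph_dist G x y = (LEAST l. \<exists>p. walk G x p y \<and> length p = Suc l)"

definition edge_dist :: "'a graph \<Rightarrow> 'a \<Rightarrow> 'a set \<Rightarrow> nat" where
  "edge_dist G x e = Min (graph_dist G x ` e)"

definition edge_resolving_set :: "'a graph \<Rightarrow> 'a set \<Rightarrow> bool" where
  "edge_resolving_set G R \<longleftrightarrow> R \<subseteq> verts G \<and>
     (\<forall>e\<in>edges G. \<forall>e'\<in>edges G. e \<noteq> e' \<longrightarrow> (\<exists>x\<in>R. edge_dist G x e \<noteq> edge_dist G x e'))"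

text \<open>
  The residues modulo \<open>n\<close> are represented by the natural numbers below \<open>n\<close>. The vertices
  \<open>U j\<close> are on the outer cycle, the vertices \<open>V j\<close> on the inner rim.
\<close>

datatype gp_vertex = U nat | V nat

definition gen_petersen :: "nat \<Rightarrow> nat \<Rightarrow> gp_vertex graph" where
  "gen_petersen n k =
     (U ` {..<n} \<union> V ` {..<n},
      {{U j, U ((j + 1) mod n)} | j. j < n} \<union>
      {{V j, V ((j + k) mod n)} | j. j < n} \<union>
      {{U j, V j} | j. j < n})"

lemma walk_append:
  assumes "walk G x p y" "walk G y q z"
  shows "\<exists>r. walk G x r z"
proof -
  have q: "q \<noteq> []" "hd q = y" using assms by (auto simp: walk_def)
  then obtain qs where qs: "q = y # qs" by (cases q) auto
  have p: "p \<noteq> []" "last p = y" using assms by (auto simp: walk_def)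
  have "{(p @ qs) ! i, (p @ qs) ! Suc i} \<in> edges G" if i: "Suc i < length (p @ qs)" for i
  proof (cases "Suc i < length p")
    case True
    then show ?thesis using assms(1) by (auto simp: walk_def nth_append)
  next
    case False
    have "(p @ qs) ! j = q ! (Suc j - length p)" if "length p \<le> Suc j" for j
      using that p by (cases "length p = Suc j") (auto simp: qs nth_append last_conv_nth Suc_diff_le)
    moreover have "{q ! (Suc i - length p), q ! Suc (Suc i - length p)} \<in> edges G"
      using assms(2) i False by (auto simp: walk_def qs)
    ultimately show ?thesis using False by (simp add: Suc_diff_le)
  qed
  moreover have "last (p @ qs) = z"
    using assms(2) p by (cases "qs = []") (auto simp: walk_def qs)
  ultimately have "walk G x (p @ qs) z"
    using assms p by (auto simp: walk_def qs)
  then show ?thesis ..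
qed

lemma walk_edge:
  assumes "{x, y} \<in> edges G" "x \<in> verts G" "y \<in> verts G"
  shows "walk G x [x, y] y"
  using assms by (auto simp: walk_def)

lemma connected_gen_petersen:
  assumes "n > 0"
  shows "connected_graph (gen_petersen n k)"
proof -
  let ?G = "gen_petersen n k"
  let ?W = "\<lambda>x y. \<exists>p. walk ?G x p y"
  note defs = gen_petersen_def verts_def edges_def
  have V: "?W (V j) (U j)" "?W (U j) (V j)" if "j < n" for j
    using that by (auto simp: defs insert_commute intro!: exI walk_edge)
  have U: "?W (U 0) (U j) \<and> ?W (U j) (U 0)" if "j < n" for j
    using that
  proof (induction j)
    case 0
    have "walk ?G (U 0) [U 0] (U 0)" using assms by (auto simp: walk_def defs)
    then show ?case by blast
  next
    case (Suc j)
    then have e: "{U j, U (Suc j)} \<in> edges ?G" and v: "U j \<in> verts ?G" "U (Suc j) \<in> verts ?G"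
      by (auto simp: defs intro!: exI[of _ j])
    have "?W (U j) (U (Suc j))" using walk_edge[OF e v] by blast
    moreover have "?W (U (Suc j)) (U j)" using walk_edge[of "U (Suc j)" "U j" ?G] e v
      by (auto simp: insert_commute)
    ultimately show ?case using Suc walk_append by (metis Suc_lessD)
  qed
  have A: "?W (U 0) x \<and> ?W x (U 0)" if x: "x \<in> verts ?G" for x
  proof -
    obtain j where "j < n" "x = U j \<or> x = V j" using x by (auto simp: defs)
    then show ?thesis using U[of j] V[of j] walk_append by metis
  qed
  have "verts ?G \<noteq> {}" using assms by (auto simp: defs)
  then show ?thesis
    unfolding connected_graph_def using A walk_append by metis
qed

end

theory Submission
  imports Defs
begin

text \<open>
  Among three vertices two lie on the same rim; take the third one as base. For each choice of the
  two rims there is a fixed finite list of pairs of edges, all close to the base or to its antipode,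
  such that for any two vertices of the second rim some pair on the list is unresolved by them and
  by the base. If \<open>n \<ge> 56\<close>, three positions can be removed from each of the two arcs between base
  and antipode without changing which pairs a given vertex resolves, once that vertex is moved
  along suitably; this reduces \<open>n\<close> to \<open>n - 6\<close>, and the cases \<open>11 \<le> n \<le> 55\<close> are checked by
  computation.
\<close>

text \<open>The reduction rests on a periodicity: once two positions differ by at least 3, a route
  along the inner rim is never worse, so all four distance formulas grow by exactly 1 whenever the
  difference grows by 3. Cutting 3 positions out of each arc lowers the distances both ways round
  together, and it keeps the parity of \<open>n\<close>, hence the antipode in its place. An
  unresolved pair is an equality of two distances from one vertex. If both edges lie in one short
  window, both distances change by the same amount and the equality survives; so the two edges of a
  pair always sit at the same end. Each vertex must be moved in one way that suits the whole list,
  since a single pair has to serve three vertices. The obstacle is that distance is not monotone in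
  the difference of positions. The shorter arc does not always give the distance, so both ways round
  enter the formula, and comparisons between them need a gap.\<close>

section \<open>Distances in the cyclic graph\<close>

text \<open>
  Distances in the infinite graph \<open>P(\<infinity>, 3)\<close>, the universal cover of the rim direction, between
  two vertices whose positions differ by \<open>t \<ge> 0\<close>. The two Boolean arguments tell which of the two
  vertices lie on the outer path.
\<close>

fun line_dist :: "bool \<Rightarrow> bool \<Rightarrow> int \<Rightarrow> int" where
  "line_dist True True t = min t (t div 3 + t mod 3 + 2)"
| "line_dist False False t = t div 3 + (if t mod 3 = 0 then 0 else t mod 3 + 2)"
| "line_dist True False t = t div 3 + t mod 3 + 1"
| "line_dist False True t = t div 3 + t mod 3 + 1"

definition cyc_dist :: "int \<Rightarrow> bool \<Rightarrow> bool \<Rightarrow> int \<Rightarrow> int" where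
  "cyc_dist n K K' z = min (line_dist K K' (z mod n)) (line_dist K K' (n - z mod n))"

text \<open>Without the gap of 10 this fails: on the inner rim, \<open>line_dist False False 2 = 4\<close> and
  \<open>line_dist False False 9 = 3\<close>.\<close>

lemma line_dist_mono:
  assumes "0 \<le> t" "t + 10 \<le> u"
  shows "line_dist K K' t \<le> line_dist K K' u"
proof -
  define q r q' r' where "q = t div 3" "r = t mod 3" "q' = u div 3" "r' = u mod 3"
  note defs = this
  have "t = 3 * q + r" "u = 3 * q' + r'" by (simp_all add: defs)
  moreover have "0 \<le> r" "r < 3" "0 \<le> r'" "r' < 3" by (simp_all add: defs)
  ultimately have "q + r \<le> q' + r'"
    "q + (if r = 0 then 0 else r + 2) \<le> q' + (if r' = 0 then 0 else r' + 2)"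
    using assms by auto
  then show ?thesis using assms by (cases K; cases K') (auto simp flip: defs)
qed

text \<open>From difference 3 on, the route through the inner rim is no longer than the outer path,
  which removes the minimum in the outer-outer case; 6 ensures this at \<open>t - 3\<close> as
  well.\<close>

lemma line_dist_period:
  assumes "6 \<le> t"
  shows "line_dist K K' t = line_dist K K' (t - 3) + 1"
proof -
  have "(t - 3) div 3 = t div 3 - 1" "(t - 3) mod 3 = t mod 3" by presburger+
  moreover have "t div 3 + t mod 3 + 4 \<le> t" using assms by presburger
  ultimately show ?thesis by (cases K; cases K') simp_all
qed

lemma cyc_dist_cong: "z mod n = w mod n \<Longrightarrow> cyc_dist n K K' z = cyc_dist n K K' w"
  by (simp add: cyc_dist_def)

text \<open>With \<open>cyc_dist_attained\<close> this identifies \<open>cyc_dist\<close> as the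
  minimum of \<open>line_dist\<close> over all lifts to the line, so local bounds can be proved
  there. A lift other than the two in the definition is longer than one of them by at least
  \<open>n\<close>, which \<open>line_dist_mono\<close> handles.\<close>

lemma cyc_dist_le:
  assumes "11 \<le> n"
  shows "cyc_dist n K K' w \<le> line_dist K K' \<bar>w\<bar>"
proof -
  define t k where "t = w mod n" and "k = w div n"
  have w: "w = t + k * n" and t: "0 \<le> t" "t < n"
    using assms by (auto simp: t_def k_def)
  consider "k = 0" | "k = - 1" | "1 \<le> k" | "1 \<le> - k - 1" by linarith
  then show ?thesis
  proof cases
    case 1
    then show ?thesis using t by (simp add: w cyc_dist_def)
  next
    case 2
    then have "\<bar>w\<bar> = n - t" using t by (simp add: w)
    then show ?thesis by (simp add: cyc_dist_def t_def)
  next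
    case 3
    then have "1 * n \<le> k * n" using assms by (intro mult_right_mono) simp_all
    then have "t + 10 \<le> \<bar>w\<bar>" using t assms unfolding w by linarith
    then have "line_dist K K' t \<le> line_dist K K' \<bar>w\<bar>" using line_dist_mono t by simp
    then show ?thesis by (simp add: cyc_dist_def t_def)
  next
    case 4
    then have "1 * n \<le> (- k - 1) * n" using assms by (intro mult_right_mono) simp_all
    then have "n \<le> - (k * n) - n" by (simp only: left_diff_distrib mult_minus_left mult_1)
    then have "n - t + 10 \<le> \<bar>w\<bar>" using t assms unfolding w by linarith
    then have "line_dist K K' (n - t) \<le> line_dist K K' \<bar>w\<bar>"
      using line_dist_mono[of "n - t"] t by simp
    then show ?thesis by (simp add: cyc_dist_def t_def)
  qed
qed

lemma cyc_dist_attained: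
  assumes "0 < n"
  obtains w where "w mod n = z mod n" "cyc_dist n K K' z = line_dist K K' \<bar>w\<bar>"
proof (cases "line_dist K K' (z mod n) \<le> line_dist K K' (n - z mod n)")
  case True
  then show ?thesis using that[of "z mod n"] assms by (simp add: cyc_dist_def)
next
  case False
  have "z mod n < n" using assms by simp
  then show ?thesis using False that[of "z mod n - n"] by (simp add: cyc_dist_def)
qed

section \<open>Change of the distance formulas along a single edge\<close>

lemma line_dist_nonneg: "0 \<le> t \<Longrightarrow> 0 \<le> line_dist K K' t"
  by (cases K; cases K') auto

lemma cyc_dist_nonneg: "0 < n \<Longrightarrow> 0 \<le> cyc_dist n K K' z"
  using pos_mod_bound[of n z] by (simp add: cyc_dist_def line_dist_nonneg less_imp_le)

lemma div_mod_step:
  "(t + 1) div 3 + (t + 1) mod 3 = t div 3 + t mod 3 + 1 \<or>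
    (t + 1) div 3 + (t + 1) mod 3 = t div 3 + t mod 3 - 1" for t :: int
proof -
  define q r where "q = t div 3" "r = t mod 3"
  then have t: "t = 3 * q + r" and "0 \<le> r" "r < 3" by simp_all
  then consider "r = 0" | "r = 1" | "r = 2" by linarith
  then show ?thesis by cases (simp_all add: t)
qed

lemma line_dist_outer_step:
  assumes "0 \<le> t"
  shows "\<bar>line_dist K True (t + 1) - line_dist K True t\<bar> \<le> 1"
proof -
  define x y where "x = t div 3 + t mod 3" "y = (t + 1) div 3 + (t + 1) mod 3"
  then have "y = x + 1 \<or> y = x - 1" using div_mod_step[of t] by simp
  then show ?thesis by (cases K) (auto simp flip: \<open>x = _\<close> \<open>y = _\<close>)
qed

lemma line_dist_inner_step:
  assumes "0 \<le> t"
  shows "\<bar>line_dist K False (t + 3) - line_dist K False t\<bar> \<le> 1"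
  by (cases K) simp_all

lemma line_dist_outer:
  assumes "\<bar>c\<bar> = 1"
  shows "line_dist K True \<bar>w + c\<bar> \<le> line_dist K True \<bar>w\<bar> + 1"
proof -
  consider "\<bar>w + c\<bar> = \<bar>w\<bar> + 1" | "\<bar>w\<bar> = \<bar>w + c\<bar> + 1" using assms by linarith
  then show ?thesis
    using line_dist_outer_step[OF abs_ge_zero[of w], of K]
      line_dist_outer_step[OF abs_ge_zero[of "w + c"], of K]
    by (cases; simp only:) linarith+
qed

lemma line_dist_inner:
  assumes "\<bar>c\<bar> = 3"
  shows "line_dist K False \<bar>w + c\<bar> \<le> line_dist K False \<bar>w\<bar> + 1"
proof -
  \<comment> \<open>The last two cases are inner edges straddling the base: the difference changes
    sign and \<open>line_dist_inner_step\<close> does not apply.\<close>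
  consider "\<bar>w + c\<bar> = \<bar>w\<bar> + 3" | "\<bar>w\<bar> = \<bar>w + c\<bar> + 3"
    | "\<bar>w\<bar> = 1" "\<bar>w + c\<bar> = 2" | "\<bar>w\<bar> = 2" "\<bar>w + c\<bar> = 1" using assms by linarith
  then show ?thesis
  proof cases
    case 1 then show ?thesis using line_dist_inner_step[of "\<bar>w\<bar>" K] by simp
  next
    case 2 then show ?thesis using line_dist_inner_step[of "\<bar>w + c\<bar>" K] by simp
  next
    case 3 show ?thesis unfolding 3 by (cases K) simp_all
  next
    case 4 show ?thesis unfolding 4 by (cases K) simp_all
  qed
qed

lemma line_dist_spoke:
  assumes "0 \<le> t"
  shows "line_dist K (\<not> L) t \<le> line_dist K L t + 1"
proof -
  define q r where "q = t div 3" "r = t mod 3"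
  note defs = this
  have "t = 3 * q + r" by (simp add: defs)
  moreover have "0 \<le> r" "r < 3" by (simp_all add: defs)
  ultimately have "q + r \<le> t" "0 \<le> r" "r < 3" using assms by auto
  then show ?thesis by (cases K; cases L) (auto simp flip: defs)
qed

text \<open>Shortest paths may overshoot and come back, but some shortest path ends with an edge
  from the side of the base or with a spoke, so these two neighbours suffice.\<close>

lemma line_dist_descent_outer:
  assumes "0 \<le> t" "\<not> (K \<and> t = 0)"
  shows "1 \<le> t \<and> line_dist K True (t - 1) = line_dist K True t - 1 \<or>
    line_dist K False t = line_dist K True t - 1"
proof (cases K)
  case True
  define x y where "x = t div 3 + t mod 3" "y = (t - 1) div 3 + (t - 1) mod 3"
  then have "x = y + 1 \<or> x = y - 1" using div_mod_step[of "t - 1"] by simp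
  then show ?thesis using True assms by (auto simp flip: \<open>x = _\<close> \<open>y = _\<close>)
next
  case False
  have "(t - 1) div 3 = t div 3 \<and> (t - 1) mod 3 = t mod 3 - 1" if "t mod 3 \<noteq> 0"
    using that by presburger
  moreover have "1 \<le> t" if "t mod 3 \<noteq> 0" using that assms(1) by (cases "t = 0") simp_all
  ultimately show ?thesis using False by auto
qed

lemma line_dist_descent_inner:
  assumes "0 \<le> t" "K \<or> t \<noteq> 0"
  shows "3 \<le> t \<and> line_dist K False (t - 3) = line_dist K False t - 1 \<or>
    line_dist K True t = line_dist K False t - 1"
proof (cases "3 \<le> t")
  case True
  have "(t - 3) div 3 = t div 3 - 1" "(t - 3) mod 3 = t mod 3" by presburger+
  then show ?thesis using True by (cases K) simp_all
next
  case False
  then consider "t = 0" | "t = 1" | "t = 2" using assms(1) by linarith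
  then show ?thesis using assms(2) by cases (cases K; simp)+
qed

lemma mod_add_cong: "w mod n = z mod n \<Longrightarrow> (w + c) mod n = (z + c) mod n" for n :: int
  by (metis mod_add_left_eq)

text \<open>A lift of \<open>z\<close> attaining the minimum, moved by \<open>c\<close>, is a lift
  of \<open>z + c\<close>. Spokes are the case \<open>c = 0\<close>.\<close>

lemma cyc_dist_lift:
  assumes "11 \<le> n" and "\<And>w. line_dist K L' \<bar>w + c\<bar> \<le> line_dist K L \<bar>w\<bar> + 1"
  shows "cyc_dist n K L' (z + c) \<le> cyc_dist n K L z + 1"
proof -
  obtain w where w: "w mod n = z mod n" "cyc_dist n K L z = line_dist K L \<bar>w\<bar>"
    using cyc_dist_attained[of n z K L] assms(1) by auto
  have "cyc_dist n K L' (z + c) = cyc_dist n K L' (w + c)"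
    using mod_add_cong[OF w(1)] by (metis cyc_dist_cong)
  also have "\<dots> \<le> line_dist K L' \<bar>w + c\<bar>" by (rule cyc_dist_le[OF assms(1)])
  finally show ?thesis using assms(2)[of w] w(2) by simp
qed

lemma cyc_dist_outer:
  assumes "11 \<le> n" "\<bar>c\<bar> = 1"
  shows "cyc_dist n K True (z + c) \<le> cyc_dist n K True z + 1"
  using cyc_dist_lift[OF assms(1)] line_dist_outer[OF assms(2)] by blast

lemma cyc_dist_inner:
  assumes "11 \<le> n" "\<bar>c\<bar> = 3"
  shows "cyc_dist n K False (z + c) \<le> cyc_dist n K False z + 1"
  using cyc_dist_lift[OF assms(1)] line_dist_inner[OF assms(2)] by blast

lemma cyc_dist_spoke:
  assumes "11 \<le> n"
  shows "cyc_dist n K (\<not> L) z \<le> cyc_dist n K L z + 1"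
  using cyc_dist_lift[OF assms, of K "\<not> L" 0 L z] line_dist_spoke by simp

lemma cyc_dist_descent:
  assumes "11 \<le> n" and "\<not> (K = L \<and> z mod n = 0)"
  obtains c where "\<bar>c\<bar> = (if L then 1 else 3)" "cyc_dist n K L (z + c) < cyc_dist n K L z"
  | "cyc_dist n K (\<not> L) z < cyc_dist n K L z"
proof -
  obtain w where w: "w mod n = z mod n" "cyc_dist n K L z = line_dist K L \<bar>w\<bar>"
    using cyc_dist_attained[of n z K L] assms(1) by auto
  have w0: "\<not> (K = L \<and> \<bar>w\<bar> = 0)" using assms(2) w(1) by auto
  have le: "cyc_dist n K L' (z + c) \<le> line_dist K L' \<bar>w + c\<bar>" for L' c
    using cyc_dist_le[OF assms(1), of K L' "w + c"] mod_add_cong[OF w(1)] by (metis cyc_dist_cong)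
  define k :: int where "k = (if L then 1 else 3)"
  have "k \<le> \<bar>w\<bar> \<and> line_dist K L (\<bar>w\<bar> - k) = line_dist K L \<bar>w\<bar> - 1 \<or>
      line_dist K (\<not> L) \<bar>w\<bar> = line_dist K L \<bar>w\<bar> - 1"
    using line_dist_descent_outer[of "\<bar>w\<bar>" K] line_dist_descent_inner[of "\<bar>w\<bar>" K] w0
    by (cases L) (auto simp: k_def)
  then show ?thesis
  proof
    assume *: "k \<le> \<bar>w\<bar> \<and> line_dist K L (\<bar>w\<bar> - k) = line_dist K L \<bar>w\<bar> - 1"
    \<comment> \<open>The step goes towards 0 on the line; its sign depends on which lift attains
      the minimum.\<close>
    define c where "c = (if 0 \<le> w then - k else k)"
    have "\<bar>w + c\<bar> = \<bar>w\<bar> - k" using * by (auto simp: c_def k_def)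
    then show ?thesis using that(1)[of c] le[of L c] * w(2) by (simp add: c_def k_def)
  next
    assume "line_dist K (\<not> L) \<bar>w\<bar> = line_dist K L \<bar>w\<bar> - 1"
    then show ?thesis using that(2) le[of "\<not> L" 0] w(2) by simp
  qed
qed

lemma cyc_dist_eq_0:
  assumes "11 \<le> n"
  shows "cyc_dist n K K 0 = 0"
  using cyc_dist_le[OF assms, of K K 0] cyc_dist_nonneg[of n K K 0] assms by (cases K) auto

section \<open>Direct distances, reflection and cutting out positions\<close>

lemma cyc_dist_eq_line_dist:
  assumes "11 \<le> n" "2 * \<bar>z\<bar> + 10 \<le> n"
  shows "cyc_dist n K K' z = line_dist K K' \<bar>z\<bar>"
proof (cases "0 \<le> z")
  case True
  then have "z mod n = z" using assms by simp
  then show ?thesis using True assms line_dist_mono[of z "n - z" K K'] by (simp add: cyc_dist_def)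
next
  case False
  have "z mod n = (z + n) mod n" by simp
  also have "\<dots> = z + n" using False assms by (intro mod_pos_pos_trivial) auto
  finally show ?thesis
    using False assms line_dist_mono[of "- z" "z + n" K K'] by (simp add: cyc_dist_def)
qed

lemma cyc_dist_uminus:
  assumes "0 < n"
  shows "cyc_dist n K K' (- z) = cyc_dist n K K' z"
proof (cases "z mod n = 0")
  case True
  then have "(- z) mod n = 0" by (simp add: mod_0_imp_dvd)
  then show ?thesis using True by (simp add: cyc_dist_def)
next
  case False
  then show ?thesis by (simp add: cyc_dist_def zmod_zminus1_eq_if min.commute)
qed

text \<open>Both ways round have length at least 6, so \<open>line_dist_period\<close> lowers both
  arguments of the minimum by 1.\<close>

lemma cyc_dist_shift_pos:
  assumes "6 \<le> z" "z \<le> n - 6"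
  shows "cyc_dist n K K' z = cyc_dist (n - 6) K K' (z - 3) + 1"
proof -
  have "z mod n = z" "(z - 3) mod (n - 6) = z - 3" using assms by simp_all
  then show ?thesis
    using assms line_dist_period[of z K K'] line_dist_period[of "n - z" K K']
    by (simp add: cyc_dist_def algebra_simps)
qed

lemma cyc_dist_shift_neg:
  assumes "6 \<le> z" "z \<le> n - 6"
  shows "cyc_dist n K K' (- z) = cyc_dist (n - 6) K K' (- (z - 3)) + 1"
  using cyc_dist_shift_pos[OF assms] assms by (simp only: cyc_dist_uminus)

datatype edge_kind = Outer | Inner | Spoke

fun cyc_edge_dist :: "int \<Rightarrow> bool \<Rightarrow> edge_kind \<Rightarrow> int \<Rightarrow> int" where
  "cyc_edge_dist n K Outer z = min (cyc_dist n K True z) (cyc_dist n K True (z + 1))"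
| "cyc_edge_dist n K Inner z = min (cyc_dist n K False z) (cyc_dist n K False (z + 3))"
| "cyc_edge_dist n K Spoke z = min (cyc_dist n K True z) (cyc_dist n K False z)"

lemma cyc_edge_dist_cong:
  assumes "z mod n = w mod n"
  shows "cyc_edge_dist n K e z = cyc_edge_dist n K e w"
proof -
  have "(z + c) mod n = (w + c) mod n" for c using assms by (rule mod_add_cong)
  then have "cyc_dist n K L (z + c) = cyc_dist n K L (w + c)" for L c by (rule cyc_dist_cong)
  from this[of _ 0] this show ?thesis by (cases e) simp_all
qed

section \<open>Pairs of edges near a vertex and near its antipode\<close>

text \<open>
  The pair \<open>(a, e, p, f, q)\<close> consists of an edge of kind \<open>e\<close> at position \<open>p\<close> and an edge of kind
  \<open>f\<close> at position \<open>q\<close>, counted from a base vertex if \<open>a\<close> is false and from its antipode otherwise.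
\<close>

type_synonym edge_pair = "bool \<times> edge_kind \<times> int \<times> edge_kind \<times> int"

definition origin :: "int \<Rightarrow> bool \<Rightarrow> int" where
  "origin n a = (if a then n div 2 else 0)"

text \<open>Positions are relative to the base, so the base itself is \<open>s = 0\<close>.\<close>

fun unresolved :: "int \<Rightarrow> bool \<Rightarrow> int \<Rightarrow> edge_pair \<Rightarrow> bool" where
  "unresolved n K s (a, e, p, f, q) \<longleftrightarrow>
     cyc_edge_dist n K e (origin n a + p - s) = cyc_edge_dist n K f (origin n a + q - s)"

lemma unresolved_cong:
  assumes "s mod n = t mod n"
  shows "unresolved n K s c = unresolved n K t c"
proof -
  have "(x - s) mod n = (x - t) mod n" for x using assms by (metis mod_diff_right_eq)
  then have "cyc_edge_dist n K e (x - s) = cyc_edge_dist n K e (x - t)" for e x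
    by (rule cyc_edge_dist_cong)
  then show ?thesis by (cases c) simp
qed

fun span :: "edge_kind \<Rightarrow> int" where
  "span Outer = 1"
| "span Inner = 3"
| "span Spoke = 0"

text \<open>The window from -5 to 7 is the range of endpoints that the lists below occupy. The last
  clause keeps two edges of one kind distinct modulo every \<open>n\<close> from 11 on.\<close>

fun admissible :: "edge_pair \<Rightarrow> bool" where
  "admissible (a, e, p, f, q) \<longleftrightarrow> - 5 \<le> p \<and> p + span e \<le> 7 \<and> - 5 \<le> q \<and> q + span f \<le> 7 \<and>
     (e = f \<longrightarrow> p \<noteq> q \<and> \<bar>p - q\<bar> < 11)"

text \<open>
  The offset \<open>d\<close> depends on the window, but not on the position \<open>j\<close> in it, so comparisons of
  distances within a window are preserved.
\<close>

lemma window_shift: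
  assumes "56 \<le> n" "0 \<le> s" "s < n"
  obtains s' where "s = 0 \<Longrightarrow> s' = 0" and
    "\<And>a. \<exists>d. \<forall>K K' j. - 5 \<le> j \<longrightarrow> j \<le> 7 \<longrightarrow> cyc_dist n K K' (origin n a + j - s) =
       cyc_dist (n - 6) K K' (origin (n - 6) a + j - s') + d"
proof -
  have half: "(n - 6) div 2 = n div 2 - 3" by presburger
  have m: "n \<le> 2 * (n div 2) + 1" "2 * (n div 2) \<le> n" by presburger+
  \<comment> \<open>Here 16 is 10 + 6: the direct route must also be shortest in the cycle of
    \<open>n - 6\<close> positions.\<close>
  have eq: "cyc_dist n K K' z = cyc_dist (n - 6) K K' z" if "2 * z + 16 \<le> n" "16 - 2 * z \<le> n" for z K K'
    using that assms(1) by (simp add: cyc_dist_eq_line_dist abs_if)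
  have pos: "cyc_dist n K K' z = cyc_dist (n - 6) K K' z' + 1"
    if "6 \<le> z" "z \<le> n - 6" "z' = z - 3" for z z' K K'
    using cyc_dist_shift_pos that by simp
  have neg: "cyc_dist n K K' z = cyc_dist (n - 6) K K' z' + 1"
    if "6 \<le> - z" "- z \<le> n - 6" "z' = z + 3" for z z' K K'
    using cyc_dist_shift_neg[of "- z"] that by (simp add: add.commute)
  have lift: "\<exists>d. \<forall>K K' j. - 5 \<le> j \<longrightarrow> j \<le> 7 \<longrightarrow> cyc_dist n K K' (origin n a + j - s) =
       cyc_dist (n - 6) K K' (origin (n - 6) a + j - s') + d"
    if "\<And>K K' j. - 5 \<le> j \<Longrightarrow> j \<le> 7 \<Longrightarrow>
        cyc_dist n K K' (j - s) = cyc_dist (n - 6) K K' (j - s') + d\<^sub>1"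
      and "\<And>K K' j. - 5 \<le> j \<Longrightarrow> j \<le> 7 \<Longrightarrow> cyc_dist n K K' (n div 2 + j - s) =
        cyc_dist (n - 6) K K' (n div 2 - 3 + j - s') + d\<^sub>2"
    for a s' d\<^sub>1 d\<^sub>2
    using that by (cases a) (auto simp: origin_def half)
  \<comment> \<open>Close to the base on either side, distances to the base window are kept and
    those to the antipodal window drop by 1; in the middle case it is the reverse. The limits 15 and
    \<open>n - 14\<close> are what the direct route to the antipodal window requires. In the last
    case positions \<open>n - 13\<close> and 7 are 20 apart, and 2 * 20 + 16 = 56.\<close>
  consider "s \<le> 14" | "15 \<le> s" "s \<le> n - 14" | "n - 13 \<le> s" by linarith
  then show thesis
  proof cases
    case 1
    show thesis
    proof (rule that[of s], assumption, rule lift[of _ 0 1])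
      fix K K' and j :: int assume j: "- 5 \<le> j" "j \<le> 7"
      have "2 * (j - s) + 16 \<le> n" "16 - 2 * (j - s) \<le> n" using 1 j assms by simp_all
      then show "cyc_dist n K K' (j - s) = cyc_dist (n - 6) K K' (j - s) + 0"
        using eq[of "j - s"] by simp
      show "cyc_dist n K K' (n div 2 + j - s) = cyc_dist (n - 6) K K' (n div 2 - 3 + j - s) + 1"
        by (rule pos) (use 1 j m assms in linarith)+
    qed
  next
    case 2
    show thesis
    proof (rule that[of "s - 3"], use 2 in simp, rule lift[of _ 1 0])
      fix K K' and j :: int assume j: "- 5 \<le> j" "j \<le> 7"
      show "cyc_dist n K K' (j - s) = cyc_dist (n - 6) K K' (j - (s - 3)) + 1"
        by (rule neg) (use 2 j in linarith)+
      have "2 * (n div 2 + j - s) + 16 \<le> n" "16 - 2 * (n div 2 + j - s) \<le> n"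
        using 2 j m by simp_all
      then show "cyc_dist n K K' (n div 2 + j - s) =
          cyc_dist (n - 6) K K' (n div 2 - 3 + j - (s - 3)) + 0"
        using eq[of "n div 2 + j - s"] by (simp add: algebra_simps)
    qed
  next
    case 3
    show thesis
    proof (rule that[of "s - 6"], use 3 assms in simp, rule lift[of _ 0 1])
      fix K K' and j :: int assume j: "- 5 \<le> j" "j \<le> 7"
      have "cyc_dist n K K' (j - s) = cyc_dist n K K' (j - s + n)"
        by (rule cyc_dist_cong) simp
      also have "\<dots> = cyc_dist (n - 6) K K' (j - s + n)"
        by (rule eq) (use 3 j assms in simp_all)
      also have "\<dots> = cyc_dist (n - 6) K K' (j - (s - 6) + (n - 6))"
        by (simp add: algebra_simps)
      also have "\<dots> = cyc_dist (n - 6) K K' (j - (s - 6))"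
        by (rule cyc_dist_cong) (rule mod_add_self2)
      finally show "cyc_dist n K K' (j - s) = cyc_dist (n - 6) K K' (j - (s - 6)) + 0" by simp
      show "cyc_dist n K K' (n div 2 + j - s) =
          cyc_dist (n - 6) K K' (n div 2 - 3 + j - (s - 6)) + 1"
        by (rule neg) (use 3 j m assms in linarith)+
    qed
  qed
qed

text \<open>Both edges of a pair lie in one window, so the offset \<open>d\<close> cancels. The
  order of quantifiers matters: one \<open>s'\<close> serves all pairs and both rims.\<close>

lemma unresolved_reduce:
  assumes "56 \<le> n"
  obtains s' where "s = 0 \<Longrightarrow> s' = 0"
    and "\<And>c K. admissible c \<Longrightarrow> unresolved n K s c = unresolved (n - 6) K s' c"
proof -
  have "0 \<le> s mod n" "s mod n < n" using assms by simp_all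
  from window_shift[OF assms this] obtain s' where s': "s mod n = 0 \<Longrightarrow> s' = 0"
    and shift: "\<And>a. \<exists>d. \<forall>K K' j. - 5 \<le> j \<longrightarrow> j \<le> 7 \<longrightarrow> cyc_dist n K K' (origin n a + j - s mod n) =
       cyc_dist (n - 6) K K' (origin (n - 6) a + j - s') + d" by blast
  have "unresolved n K s c = unresolved (n - 6) K s' c" if "admissible c" for c K
  proof -
    obtain a e p f q where c: "c = (a, e, p, f, q)" by (cases c)
    obtain d where d: "\<And>K' j. - 5 \<le> j \<Longrightarrow> j \<le> 7 \<Longrightarrow>
        cyc_dist n K K' (origin n a + j - s mod n) =
        cyc_dist (n - 6) K K' (origin (n - 6) a + j - s') + d" using shift[of a] by blast
    have "cyc_dist n K K' (origin n a + j - s mod n + i) =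
        cyc_dist (n - 6) K K' (origin (n - 6) a + j - s' + i) + d"
      if "- 5 \<le> j + i" "j + i \<le> 7" for j i K'
      using d[OF that] by (simp add: algebra_simps)
    \<comment> \<open>Offset 0 is the near endpoint; 1 and 3 are the far endpoints of outer and
      inner edges.\<close>
    from this[of _ 0] this[of _ 1] this[of _ 3]
    have "cyc_edge_dist n K e (origin n a + j - s mod n) =
        cyc_edge_dist (n - 6) K e (origin (n - 6) a + j - s') + d"
      if "- 5 \<le> j" "j + span e \<le> 7" for e j
      using that by (cases e) (simp_all add: min_add_distrib_left)
    then have "unresolved n K (s mod n) c = unresolved (n - 6) K s' c"
      using \<open>admissible c\<close> by (simp add: c)
    moreover have "unresolved n K (s mod n) c = unresolved n K s c"
      by (rule unresolved_cong) simp
    ultimately show ?thesis by simp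
  qed
  then show thesis by (intro that[of s']) (use s' in simp)
qed

text \<open>\<open>s\<close> and \<open>t\<close> range over all integers, so the reduction may
  replace them without range conditions.\<close>

definition unresolvable :: "bool \<Rightarrow> bool \<Rightarrow> edge_pair list \<Rightarrow> int \<Rightarrow> bool" where
  "unresolvable K K' P n \<longleftrightarrow>
     (\<forall>s t. \<exists>c\<in>set P. unresolved n K 0 c \<and> unresolved n K' s c \<and> unresolved n K' t c)"

lemma unresolvable_step:
  assumes "56 \<le> n" "list_all admissible P" "unresolvable K K' P (n - 6)"
  shows "unresolvable K K' P n"
  unfolding unresolvable_def
proof (intro allI)
  fix s t
  obtain s' where s': "\<And>c K. admissible c \<Longrightarrow> unresolved n K s c = unresolved (n - 6) K s' c"
    by (rule unresolved_reduce[OF assms(1), of s]) blast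
  obtain t' where t': "\<And>c K. admissible c \<Longrightarrow> unresolved n K t c = unresolved (n - 6) K t' c"
    by (rule unresolved_reduce[OF assms(1), of t]) blast
  have z: "admissible c \<Longrightarrow> unresolved n K 0 c = unresolved (n - 6) K 0 c" for c K
    by (rule unresolved_reduce[OF assms(1), of 0]) auto
  obtain c where c: "c \<in> set P" "unresolved (n - 6) K 0 c" "unresolved (n - 6) K' s' c"
      "unresolved (n - 6) K' t' c"
    using assms(3) unfolding unresolvable_def by blast
  moreover from c(1) have "admissible c" using assms(2) by (simp add: list_all_iff)
  ultimately show "\<exists>c\<in>set P. unresolved n K 0 c \<and> unresolved n K' s c \<and> unresolved n K' t c"
    using s' t' z by blast
qed

section \<open>The graph metric\<close>

text \<open>Descending along \<open>desc\<close> yields a walk of length \<open>D y\<close>, and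
  \<open>lip\<close> forbids a shorter one. Distances are thus verified edge by edge, without
  analysing paths.\<close>

lemma graph_dist_eqI:
  fixes D :: "'a \<Rightarrow> nat"
  assumes x: "x \<in> verts G" "D x = 0" and y: "y \<in> verts G"
    and lip: "\<And>u v. {u, v} \<in> edges G \<Longrightarrow> u \<in> verts G \<Longrightarrow> v \<in> verts G \<Longrightarrow> D v \<le> D u + 1"
    and desc: "\<And>v. v \<in> verts G \<Longrightarrow> v \<noteq> x \<Longrightarrow> \<exists>u\<in>verts G. {u, v} \<in> edges G \<and> D u < D v"
  shows "graph_dist G x y = D y"
  unfolding graph_dist_def
proof (rule Least_equality)
  have "\<exists>p. walk G x p v \<and> length p = Suc (D v)" if "v \<in> verts G" for v
    using that
  proof (induction "D v" arbitrary: v rule: less_induct)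
    case less
    show ?case
    proof (cases "v = x")
      case True
      then have "walk G x [x] v" using x by (simp add: walk_def)
      then show ?thesis using True x by (intro exI[of _ "[x]"]) simp
    next
      case False
      then obtain u where u: "u \<in> verts G" "{u, v} \<in> edges G" "D u < D v"
        using desc less.prems by blast
      then have D: "D v = Suc (D u)" using lip[OF u(2) u(1) less.prems] by simp
      obtain p where p: "walk G x p u" "length p = Suc (D u)" using less.hyps[OF u(3) u(1)] by blast
      have "walk G x (p @ [v]) v"
        unfolding walk_def
      proof (intro conjI allI impI)
        fix i assume i: "Suc i < length (p @ [v])"
        show "{(p @ [v]) ! i, (p @ [v]) ! Suc i} \<in> edges G"
        proof (cases "Suc i < length p")
          case True
          then show ?thesis using p(1) by (simp add: walk_def nth_append)
        next
          case False
          then have "Suc i = length p" using i by simp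
          then have "(p @ [v]) ! i = u" "(p @ [v]) ! Suc i = v"
            using p(1) by (auto simp: walk_def nth_append last_conv_nth simp flip: \<open>Suc i = length p\<close>)
          then show ?thesis using u(2) by simp
        qed
      qed (use p(1) less.prems in \<open>auto simp: walk_def\<close>)
      then show ?thesis using D p(2) by (intro exI[of _ "p @ [v]"]) simp
    qed
  qed
  then show "\<exists>p. walk G x p y \<and> length p = Suc (D y)" using y by blast
next
  fix l assume "\<exists>p. walk G x p y \<and> length p = Suc l"
  then obtain p where p: "walk G x p y" "length p = Suc l" by blast
  have "D (p ! i) \<le> i" if "i < length p" for i
    using that
  proof (induction i)
    case 0
    then show ?case using p(1) x by (simp add: walk_def hd_conv_nth)
  next
    case (Suc i)
    then have "{p ! i, p ! Suc i} \<in> edges G" "p ! i \<in> verts G" "p ! Suc i \<in> verts G"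
      using p(1) by (auto simp: walk_def)
    then have "D (p ! Suc i) \<le> D (p ! i) + 1" by (rule lip)
    then show ?case using Suc by simp
  qed
  moreover have "p ! l = y" using p by (auto simp: walk_def last_conv_nth)
  ultimately show "D y \<le> l" using p(2) by fastforce
qed

text \<open>Any integer names a position, so neighbours and rotations are plain additions without
  wrapping.\<close>

definition vert :: "nat \<Rightarrow> bool \<Rightarrow> int \<Rightarrow> gp_vertex" where
  "vert n K z = (if K then U else V) (nat (z mod int n))"

fun gp_edge :: "nat \<Rightarrow> edge_kind \<Rightarrow> int \<Rightarrow> gp_vertex set" where
  "gp_edge n Outer z = {vert n True z, vert n True (z + 1)}"
| "gp_edge n Inner z = {vert n False z, vert n False (z + 3)}"
| "gp_edge n Spoke z = {vert n True z, vert n False z}"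

lemma vert_eq_iff:
  assumes "0 < n"
  shows "vert n K z = vert n L w \<longleftrightarrow> K = L \<and> z mod int n = w mod int n"
  using assms by (auto simp: vert_def eq_nat_nat_iff)

lemma vert_in_verts: "0 < n \<Longrightarrow> vert n K z \<in> verts (gen_petersen n k)"
  by (auto simp: vert_def gen_petersen_def verts_def nat_less_iff)

lemma vert_cases:
  assumes "v \<in> verts (gen_petersen n k)"
  obtains K z where "v = vert n K z"
proof -
  from assms obtain j where "j < n" "v = U j \<or> v = V j"
    by (auto simp: gen_petersen_def verts_def)
  then have "v = vert n True (int j) \<or> v = vert n False (int j)" by (auto simp: vert_def)
  then show thesis using that by blast
qed

lemma nat_mod_add:
  assumes "0 < n"
  shows "nat ((z + int k) mod int n) = (nat (z mod int n) + k) mod n"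
proof -
  have nat: "int (nat (z mod int n)) = z mod int n"
    by (rule int_nat_eq[THEN trans]) (use assms in simp)
  have "(z + int k) mod int n = (z mod int n + int k) mod int n" by (simp only: mod_add_left_eq)
  also have "\<dots> = int ((nat (z mod int n) + k) mod n)" by (simp only: zmod_int of_nat_add nat)
  finally show ?thesis by (simp only: nat_int)
qed

lemma gp_edge_in_edges:
  assumes "0 < n"
  shows "gp_edge n e z \<in> edges (gen_petersen n 3)"
proof -
  have "nat (z mod int n) < n" using assms by (simp add: nat_less_iff)
  then show ?thesis
    using assms nat_mod_add[OF assms, of z 1] nat_mod_add[OF assms, of z 3]
    by (cases e) (auto simp: gen_petersen_def edges_def vert_def)
qed

lemma gp_edge_cases:
  assumes "E \<in> edges (gen_petersen n 3)"
  obtains e z where "E = gp_edge n e z"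
proof -
  from assms obtain j where j: "j < n"
    and E: "E = {U j, U ((j + 1) mod n)} \<or> E = {V j, V ((j + 3) mod n)} \<or> E = {U j, V j}"
    by (auto simp: gen_petersen_def edges_def)
  have "U j = vert n True (int j)" "V j = vert n False (int j)"
    "U ((j + 1) mod n) = vert n True (int j + 1)" "V ((j + 3) mod n) = vert n False (int j + 3)"
    using j nat_mod_add[of n "int j" 1] nat_mod_add[of n "int j" 3] by (auto simp: vert_def)
  then have "E = gp_edge n Outer (int j) \<or> E = gp_edge n Inner (int j) \<or> E = gp_edge n Spoke (int j)"
    using E by auto
  then show thesis using that by blast
qed

lemma graph_dist_vert:
  assumes "11 \<le> n"
  shows "graph_dist (gen_petersen n 3) (vert n K s) (vert n L z) = nat (cyc_dist (int n) K L (z - s))"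
proof -
  let ?G = "gen_petersen n 3"
  \<comment> \<open>A function on vertices has to pick one representative position; the fact
    \<open>D\<close> below shows that all others give the same value.\<close>
  define D where "D v = (case v of U j \<Rightarrow> nat (cyc_dist (int n) K True (int j - s))
    | V j \<Rightarrow> nat (cyc_dist (int n) K False (int j - s)))" for v
  have n: "0 < n" "11 \<le> int n" using assms by simp_all
  have D: "D (vert n L z) = nat (cyc_dist (int n) K L (z - s))" for L z
  proof -
    have "(z mod int n - s) mod int n = (z - s) mod int n" by (simp add: mod_simps)
    then have "cyc_dist (int n) K L (z mod int n - s) = cyc_dist (int n) K L (z - s)" for L
      by (rule cyc_dist_cong)
    then show ?thesis using n by (cases L) (simp_all add: D_def vert_def)
  qed
  have "D v \<le> D u + 1" if uv: "{u, v} \<in> edges ?G" for u v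
  proof -
    obtain e w where e: "{u, v} = gp_edge n e w" using uv by (rule gp_edge_cases)
    have outer: "cyc_dist (int n) K True (w + 1 - s) \<le> cyc_dist (int n) K True (w - s) + 1"
      "cyc_dist (int n) K True (w - s) \<le> cyc_dist (int n) K True (w + 1 - s) + 1"
      using cyc_dist_outer[OF n(2), of 1 K "w - s"] cyc_dist_outer[OF n(2), of "- 1" K "w + 1 - s"]
      by (simp_all add: diff_add_eq)
    have inner: "cyc_dist (int n) K False (w + 3 - s) \<le> cyc_dist (int n) K False (w - s) + 1"
      "cyc_dist (int n) K False (w - s) \<le> cyc_dist (int n) K False (w + 3 - s) + 1"
      using cyc_dist_inner[OF n(2), of 3 K "w - s"] cyc_dist_inner[OF n(2), of "- 3" K "w + 3 - s"]
      by (simp_all add: diff_add_eq)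
    have spoke: "cyc_dist (int n) K False (w - s) \<le> cyc_dist (int n) K True (w - s) + 1"
      "cyc_dist (int n) K True (w - s) \<le> cyc_dist (int n) K False (w - s) + 1"
      using cyc_dist_spoke[OF n(2), of K True "w - s"] cyc_dist_spoke[OF n(2), of K False "w - s"]
      by simp_all
    have step: "nat x \<le> nat y + 1" if "x \<le> y + 1" for x y
      using that by simp
    show ?thesis
    proof (cases e)
      case Outer
      then have "u = vert n True w \<and> v = vert n True (w + 1) \<or>
          u = vert n True (w + 1) \<and> v = vert n True w" using e by (simp add: doubleton_eq_iff)
      then show ?thesis using outer[THEN step] by (elim disjE conjE) (simp_all only: D)
    next
      case Inner
      then have "u = vert n False w \<and> v = vert n False (w + 3) \<or>
          u = vert n False (w + 3) \<and> v = vert n False w" using e by (simp add: doubleton_eq_iff)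
      then show ?thesis using inner[THEN step] by (elim disjE conjE) (simp_all only: D)
    next
      case Spoke
      then have "u = vert n True w \<and> v = vert n False w \<or>
          u = vert n False w \<and> v = vert n True w" using e by (simp add: doubleton_eq_iff)
      then show ?thesis using spoke[THEN step] by (elim disjE conjE) (simp_all only: D)
    qed
  qed
  moreover have "\<exists>u\<in>verts ?G. {u, v} \<in> edges ?G \<and> D u < D v"
    if v: "v \<in> verts ?G" "v \<noteq> vert n K s" for v
  proof -
    obtain L w where w: "v = vert n L w" by (rule vert_cases[OF v(1)])
    have "\<not> (K = L \<and> (w - s) mod int n = 0)"
      using v(2) n(1) by (auto simp: w vert_eq_iff mod_eq_dvd_iff mod_0_imp_dvd)
    from cyc_dist_descent[OF n(2) this] show ?thesis
    proof cases
      case (1 c)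
      have "{vert n L (w + c), vert n L w} \<in> edges ?G"
      proof (cases "0 \<le> c")
        case True
        then show ?thesis
          using gp_edge_in_edges[OF n(1), of Outer w] gp_edge_in_edges[OF n(1), of Inner w] 1(1)
          by (cases L) (simp_all add: insert_commute)
      next
        case False
        then have "c = (if L then - 1 else - 3)" using 1(1) by auto
        then show ?thesis
          using gp_edge_in_edges[OF n(1), of Outer "w + c"] gp_edge_in_edges[OF n(1), of Inner "w + c"]
          by (cases L) simp_all
      qed
      moreover have "D (vert n L (w + c)) < D v"
        using 1(2) cyc_dist_nonneg[of "int n" K L "w - s + c"] n by (simp add: w D algebra_simps)
      ultimately show ?thesis using vert_in_verts[OF n(1)] w by blast
    next
      case 2
      have "{vert n (\<not> L) w, vert n L w} \<in> edges ?G"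
        using gp_edge_in_edges[OF n(1), of Spoke w] by (cases L) (simp_all add: insert_commute)
      moreover have "D (vert n (\<not> L) w) < D v"
        using 2 cyc_dist_nonneg[of "int n" K "\<not> L" "w - s"] n by (simp add: w D)
      ultimately show ?thesis using vert_in_verts[OF n(1)] w by blast
    qed
  qed
  moreover have "D (vert n K s) = 0" using cyc_dist_eq_0[OF n(2)] by (simp add: D)
  ultimately have "graph_dist ?G (vert n K s) (vert n L z) = D (vert n L z)"
    using vert_in_verts[OF n(1)] by (intro graph_dist_eqI) auto
  then show ?thesis by (simp add: D)
qed

section \<open>From unresolved pairs to edge resolving sets\<close>

lemma edge_dist_gp_edge:
  assumes "11 \<le> n"
  shows "edge_dist (gen_petersen n 3) (vert n K s) (gp_edge n e z) =
    nat (cyc_edge_dist (int n) K e (z - s))"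
proof -
  have "nat (min x y) = min (nat x) (nat y)" for x y by (auto simp: min_def)
  then show ?thesis
    by (cases e) (simp_all add: edge_dist_def graph_dist_vert[OF assms] diff_add_eq)
qed

text \<open>Edges of one kind could also agree with their ends swapped; that would make
  \<open>n\<close> divide 2 or 6.\<close>

lemma gp_edge_inj:
  assumes "11 \<le> n" "gp_edge n e z = gp_edge n f w"
  shows "e = f \<and> z mod int n = w mod int n"
proof -
  have n: "0 < n" using assms(1) by simp
  have "\<not> int n dvd 2" "\<not> int n dvd 6" using assms(1) by (auto dest: zdvd_imp_le)
  moreover have "int n dvd 2 * c" if "int n dvd z - (w + c)" "int n dvd z + c - w" for c
    using dvd_diff[OF that(2,1)] by (simp add: algebra_simps)
  from this[of 1] this[of 3] calculation show ?thesis
    using assms(2) n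
    by (cases e; cases f) (auto simp: doubleton_eq_iff vert_eq_iff mod_eq_dvd_iff)
qed

text \<open>Distances depend only on differences of positions. Rotating the base to 0 puts the
  others at \<open>t - s\<close> and \<open>u - s\<close>; the pair found there is rotated back by
  \<open>s\<close>.\<close>

lemma not_resolved:
  assumes "11 \<le> n" "unresolvable K K' P (int n)" "list_all admissible P"
  shows "\<not> edge_resolving_set (gen_petersen n 3) {vert n K s, vert n K' t, vert n K' u}"
proof
  let ?G = "gen_petersen n 3"
  assume res: "edge_resolving_set ?G {vert n K s, vert n K' t, vert n K' u}"
  have n: "0 < n" using assms(1) by simp
  obtain c where c: "c \<in> set P" "unresolved (int n) K 0 c" "unresolved (int n) K' (t - s) c"
      "unresolved (int n) K' (u - s) c"
    using assms(2) unfolding unresolvable_def by blast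
  obtain a e p f q where c_eq: "c = (a, e, p, f, q)" by (cases c)
  define o1 where "o1 = origin (int n) a + s"
  have "admissible c" using c(1) assms(3) unfolding list_all_iff by blast
  then have adm: "e = f \<longrightarrow> p \<noteq> q \<and> \<bar>p - q\<bar> < 11" by (simp add: c_eq)
  have ne: "gp_edge n e (o1 + p) \<noteq> gp_edge n f (o1 + q)"
  proof
    assume "gp_edge n e (o1 + p) = gp_edge n f (o1 + q)"
    from gp_edge_inj[OF assms(1) this] have ef: "e = f" "int n dvd p - q"
      by (simp_all add: mod_eq_dvd_iff)
    then have "p - q \<noteq> 0" "\<bar>p - q\<bar> < int n" using adm assms(1) by auto
    then show False using ef(2) zdvd_imp_le[of "int n" "\<bar>p - q\<bar>"] by simp
  qed
  have "\<forall>E\<in>edges ?G. \<forall>E'\<in>edges ?G. E \<noteq> E' \<longrightarrow>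
      (\<exists>x\<in>{vert n K s, vert n K' t, vert n K' u}. edge_dist ?G x E \<noteq> edge_dist ?G x E')"
    using res unfolding edge_resolving_set_def by (rule conjunct2)
  from this[THEN bspec, OF gp_edge_in_edges[OF n], THEN bspec, OF gp_edge_in_edges[OF n], THEN mp, OF ne]
  obtain x where x: "x \<in> {vert n K s, vert n K' t, vert n K' u}"
    "edge_dist ?G x (gp_edge n e (o1 + p)) \<noteq> edge_dist ?G x (gp_edge n f (o1 + q))" ..
  have "edge_dist ?G (vert n L r) (gp_edge n e (o1 + p)) = edge_dist ?G (vert n L r) (gp_edge n f (o1 + q))"
    if "unresolved (int n) L (r - s) c" for L r
  proof -
    have "origin (int n) a + j - (r - s) = o1 + j - r" for j by (simp add: o1_def)
    then show ?thesis
      using that by (simp only: edge_dist_gp_edge[OF assms(1)] c_eq unresolved.simps)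
  qed
  from this[of K s] this[of K' t] this[of K' u] c
  have "edge_dist ?G x (gp_edge n e (o1 + p)) = edge_dist ?G x (gp_edge n f (o1 + q))"
    using x(1) by (simp only: diff_self) blast
  then show False using x(2) by simp
qed

section \<open>Checking small cycles\<close>

fun meets :: "bool list \<Rightarrow> bool list \<Rightarrow> bool" where
  "meets (True # as) (True # bs) \<longleftrightarrow> True"
| "meets (False # as) (b # bs) \<longleftrightarrow> meets as bs"
| "meets (True # as) (False # bs) \<longleftrightarrow> meets as bs"
| "meets _ _ \<longleftrightarrow> False"

text \<open>Each entry is also compared with itself, because after \<open>remdups\<close> two
  vertices may share one entry.\<close>

fun pairwise_meet :: "bool list list \<Rightarrow> bool" where
  "pairwise_meet [] \<longleftrightarrow> True"
| "pairwise_meet (x # xs) \<longleftrightarrow> list_all (meets x) (x # xs) \<and> pairwise_meet xs"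

text \<open>The first two entries are split off because the simplifier does not unroll \<open>[0..n - 1]\<close>.\<close>

abbreviation (input) residues :: "int \<Rightarrow> int list" where
  "residues n \<equiv> 0 # 1 # [2..n - 1]"

text \<open>Each residue becomes a Boolean vector over the pairs that the base misses, and
  \<open>remdups\<close> merges residues that behave alike before the quadratic comparison. The sign
  in \<open>- i\<close> turns the difference in \<open>unresolved\<close> into a sum;
  \<open>- i\<close> runs through all residues as well.\<close>

definition check :: "bool \<Rightarrow> bool \<Rightarrow> edge_pair list \<Rightarrow> int \<Rightarrow> bool" where
  "check K K' P n \<longleftrightarrow> pairwise_meet (remdups
     (map (\<lambda>i. map (unresolved n K' (- i)) (filter (unresolved n K 0) P)) (residues n)))"

lemma meets_map: "meets (map f cs) (map g cs) \<longleftrightarrow> (\<exists>c\<in>set cs. f c \<and> g c)"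
proof (induction cs)
  case (Cons c cs)
  then show ?case by (cases "f c"; cases "g c") auto
qed simp

lemma pairwise_meetD:
  "pairwise_meet ms \<Longrightarrow> x \<in> set ms \<Longrightarrow> y \<in> set ms \<Longrightarrow> meets x y \<or> meets y x"
  by (induction ms) (auto simp: list_all_iff)

lemma check_unresolvable:
  assumes "1 < n" "check K K' P n"
  shows "unresolvable K K' P n"
  unfolding unresolvable_def
proof (intro allI)
  fix s t
  let ?m = "\<lambda>i. map (unresolved n K' (- i)) (filter (unresolved n K 0) P)"
  have "r mod n \<in> set (residues n)" for r
  proof -
    have "0 \<le> r mod n" "r mod n < n" using assms(1) by simp_all
    then consider "r mod n = 0" | "r mod n = 1" | "2 \<le> r mod n" "r mod n \<le> n - 1" by linarith
    then show ?thesis by cases simp_all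
  qed
  then have "?m (r mod n) \<in> set (remdups (map ?m (residues n)))" for r
    unfolding set_remdups set_map by (rule imageI)
  moreover have "pairwise_meet (remdups (map ?m (residues n)))"
    using assms(2) by (simp only: check_def)
  ultimately have "meets (?m ((- s) mod n)) (?m ((- t) mod n)) \<or>
      meets (?m ((- t) mod n)) (?m ((- s) mod n))"
    by (intro pairwise_meetD)
  moreover have "unresolved n K' (- ((- r) mod n)) c = unresolved n K' r c" for r c
    by (rule unresolved_cong) (simp add: mod_minus_eq)
  ultimately show "\<exists>c\<in>set P. unresolved n K 0 c \<and> unresolved n K' s c \<and> unresolved n K' t c"
    by (simp only: meets_map set_filter mem_Collect_eq) blast
qed

text \<open>
  These lists were found by a greedy computer search. The first letter of the suffix is the rim of
  the base vertex, the other two are the common rim of the remaining vertices.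
\<close>

definition pairs_UUU :: "edge_pair list" where
  "pairs_UUU =
   [(False, Inner, -4, Inner, -2), (False, Inner, 1, Inner, 3),
    (False, Outer, -2, Spoke, -1), (False, Inner, 2, Inner, 4),
    (False, Outer, 2, Spoke, 3), (False, Outer, 3, Spoke, 4),
    (False, Outer, 2, Spoke, 2), (False, Outer, 0, Spoke, 0),
    (False, Outer, -5, Spoke, -5), (False, Inner, -2, Inner, 3),
    (False, Outer, -3, Spoke, -2), (False, Spoke, -2, Spoke, 2),
    (False, Inner, -1, Inner, 1), (True, Inner, 0, Inner, 2),
    (False, Outer, -1, Spoke, 0), (True, Inner, -2, Inner, 0)]"

definition pairs_UVV :: "edge_pair list" where
  "pairs_UVV =
   [(False, Outer, -1, Outer, 0), (True, Outer, -1, Outer, 0),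
    (True, Outer, -3, Outer, -2), (True, Inner, -3, Spoke, -3),
    (True, Outer, 0, Outer, 1), (True, Spoke, 1, Outer, 3),
    (True, Inner, 0, Spoke, 3), (True, Outer, -2, Outer, -1),
    (False, Spoke, -2, Spoke, 3), (False, Outer, -3, Spoke, 2),
    (True, Spoke, -1, Outer, 2), (True, Inner, -1, Spoke, 2),
    (True, Inner, 0, Spoke, 0), (True, Outer, -3, Outer, 1),
    (False, Inner, -2, Inner, 1), (True, Spoke, 0, Outer, 2),
    (True, Inner, -1, Inner, 1), (False, Outer, -3, Inner, 3)]"

definition pairs_VUU :: "edge_pair list" where
  "pairs_VUU =
   [(False, Inner, -4, Inner, -2), (False, Outer, -2, Spoke, -1),
    (False, Outer, -3, Outer, -2), (False, Outer, 1, Spoke, 1),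
    (False, Outer, 1, Outer, 2), (False, Inner, -1, Inner, 1),
    (True, Outer, -1, Outer, 0), (True, Inner, -2, Inner, 0),
    (True, Outer, 0, Outer, 1), (False, Inner, -2, Spoke, -2),
    (False, Inner, -1, Spoke, 2), (False, Inner, 3, Spoke, 3),
    (True, Outer, -2, Spoke, -1), (True, Outer, 1, Spoke, 1),
    (False, Inner, -4, Inner, 1), (True, Inner, -2, Spoke, -2),
    (True, Inner, -1, Spoke, -1), (True, Outer, -2, Outer, -1),
    (True, Spoke, -2, Spoke, 3), (True, Outer, -2, Spoke, -2),
    (True, Outer, 0, Spoke, 1), (True, Outer, 1, Spoke, 2),
    (True, Outer, 2, Spoke, 3), (True, Spoke, 0, Spoke, 1),
    (True, Outer, 0, Spoke, 3), (False, Spoke, -4, Inner, 1),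
    (True, Spoke, -2, Inner, 3)]"

definition pairs_VVV :: "edge_pair list" where
  "pairs_VVV =
   [(False, Outer, 1, Outer, 2), (False, Outer, 2, Outer, 3),
    (False, Outer, -3, Outer, -2), (False, Outer, -4, Outer, -3),
    (True, Outer, -2, Outer, -1), (True, Outer, -1, Outer, 0),
    (False, Outer, -2, Outer, 3), (False, Outer, -3, Outer, 2),
    (False, Outer, -1, Outer, 0), (False, Outer, -4, Outer, 1),
    (True, Outer, -1, Outer, 2)]"

lemma pairs_admissible:
  "list_all admissible pairs_UUU" "list_all admissible pairs_UVV"
  "list_all admissible pairs_VUU" "list_all admissible pairs_VVV"
  by (simp_all add: pairs_UUU_def pairs_UVV_def pairs_VUU_def pairs_VVV_def)

definition good :: "int \<Rightarrow> bool" where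
  "good n \<longleftrightarrow> check True True pairs_UUU n \<and> check True False pairs_UVV n \<and>
     check False True pairs_VUU n \<and> check False False pairs_VVV n"

text \<open>
  Instantiated with a numeral and simplified, the next two lemmas turn into tables of distances,
  which make the checks feasible for the simplifier.
\<close>

lemma cyc_dist_table:
  assumes "1 < n"
  shows "list_all (\<lambda>t.
      cyc_dist n True True t = min (line_dist True True t) (line_dist True True (n - t)) \<and>
      cyc_dist n True False t = min (line_dist True False t) (line_dist True False (n - t)) \<and>
      cyc_dist n False False t = min (line_dist False False t) (line_dist False False (n - t)))
    (residues n)"
  using assms by (auto simp: list_all_iff cyc_dist_def simp del: line_dist.simps)

lemma cyc_edge_dist_table:
  "list_all (\<lambda>t.
      cyc_edge_dist n True Outer t = min (cyc_dist n True True t) (cyc_dist n True True (t + 1)) \<and>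
      cyc_edge_dist n True Inner t = min (cyc_dist n True False t) (cyc_dist n True False (t + 3)) \<and>
      cyc_edge_dist n True Spoke t = min (cyc_dist n True True t) (cyc_dist n True False t) \<and>
      cyc_edge_dist n False Outer t = min (cyc_dist n True False t) (cyc_dist n True False (t + 1)) \<and>
      cyc_edge_dist n False Inner t = min (cyc_dist n False False t) (cyc_dist n False False (t + 3)) \<and>
      cyc_edge_dist n False Spoke t = min (cyc_dist n True False t) (cyc_dist n False False t))
    (residues n)"
proof -
  \<comment> \<open>By this symmetry the three columns of \<open>cyc_dist_table\<close>
    suffice.\<close>
  have "cyc_dist n False True t = cyc_dist n True False t" for t by (simp add: cyc_dist_def)
  then show ?thesis by (simp add: list_all_iff)
qed

lemma cyc_dist_high: "n \<le> t \<Longrightarrow> cyc_dist n K L t = cyc_dist n K L (t - n)"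
  by (rule cyc_dist_cong) simp

lemma cyc_edge_dist_high: "n \<le> t \<Longrightarrow> cyc_edge_dist n K e t = cyc_edge_dist n K e (t - n)"
  by (rule cyc_edge_dist_cong) simp

lemma cyc_edge_dist_low: "t < 0 \<Longrightarrow> cyc_edge_dist n K e t = cyc_edge_dist n K e (t + n)"
  by (rule cyc_edge_dist_cong) simp

text \<open>Rewriting is steered: \<open>line_dist\<close> unfolds only at numerals, arguments
  outside the range from 0 to \<open>n - 1\<close> are folded back, and edge distances are looked up
  in the table instead of being unfolded at every use.\<close>

context
  notes [simp del] = line_dist.simps cyc_edge_dist.simps
    and [simp] = cyc_dist_high cyc_edge_dist_high cyc_edge_dist_low
      line_dist.simps[of 0] line_dist.simps[of 1] line_dist.simps[of "numeral w" for w]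
      good_def check_def origin_def pairs_UUU_def pairs_UVV_def pairs_VUU_def pairs_VVV_def
begin

private lemma [simp]: "good 11"
proof -
  note [simp] = cyc_dist_table[of 11, simplified]
  note [simp] = cyc_edge_dist_table[of 11, simplified]
  show ?thesis by simp
qed

private lemma [simp]: "good 12"
proof -
  note [simp] = cyc_dist_table[of 12, simplified]
  note [simp] = cyc_edge_dist_table[of 12, simplified]
  show ?thesis by simp
qed

private lemma [simp]: "good 13"
proof -
  note [simp] = cyc_dist_table[of 13, simplified]
  note [simp] = cyc_edge_dist_table[of 13, simplified]
  show ?thesis by simp
qed

private lemma [simp]: "good 14"
proof -
  note [simp] = cyc_dist_table[of 14, simplified]
  note [simp] = cyc_edge_dist_table[of 14, simplified]
  show ?thesis by simp
qed

private lemma [simp]: "good 15"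
proof -
  note [simp] = cyc_dist_table[of 15, simplified]
  note [simp] = cyc_edge_dist_table[of 15, simplified]
  show ?thesis by simp
qed

private lemma [simp]: "good 16"
proof -
  note [simp] = cyc_dist_table[of 16, simplified]
  note [simp] = cyc_edge_dist_table[of 16, simplified]
  show ?thesis by simp
qed

private lemma [simp]: "good 17"
proof -
  note [simp] = cyc_dist_table[of 17, simplified]
  note [simp] = cyc_edge_dist_table[of 17, simplified]
  show ?thesis by simp
qed

private lemma [simp]: "good 18"
proof -
  note [simp] = cyc_dist_table[of 18, simplified]
  note [simp] = cyc_edge_dist_table[of 18, simplified]
  show ?thesis by simp
qed

private lemma [simp]: "good 19"
proof -
  note [simp] = cyc_dist_table[of 19, simplified]
  note [simp] = cyc_edge_dist_table[of 19, simplified]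
  show ?thesis by simp
qed

private lemma [simp]: "good 20"
proof -
  note [simp] = cyc_dist_table[of 20, simplified]
  note [simp] = cyc_edge_dist_table[of 20, simplified]
  show ?thesis by simp
qed

private lemma [simp]: "good 21"
proof -
  note [simp] = cyc_dist_table[of 21, simplified]
  note [simp] = cyc_edge_dist_table[of 21, simplified]
  show ?thesis by simp
qed

private lemma [simp]: "good 22"
proof -
  note [simp] = cyc_dist_table[of 22, simplified]
  note [simp] = cyc_edge_dist_table[of 22, simplified]
  show ?thesis by simp
qed

private lemma [simp]: "good 23"
proof -
  note [simp] = cyc_dist_table[of 23, simplified]
  note [simp] = cyc_edge_dist_table[of 23, simplified]
  show ?thesis by simp
qed

private lemma [simp]: "good 24"
proof -
  note [simp] = cyc_dist_table[of 24, simplified]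
  note [simp] = cyc_edge_dist_table[of 24, simplified]
  show ?thesis by simp
qed

private lemma [simp]: "good 25"
proof -
  note [simp] = cyc_dist_table[of 25, simplified]
  note [simp] = cyc_edge_dist_table[of 25, simplified]
  show ?thesis by simp
qed

private lemma [simp]: "good 26"
proof -
  note [simp] = cyc_dist_table[of 26, simplified]
  note [simp] = cyc_edge_dist_table[of 26, simplified]
  show ?thesis by simp
qed

private lemma [simp]: "good 27"
proof -
  note [simp] = cyc_dist_table[of 27, simplified]
  note [simp] = cyc_edge_dist_table[of 27, simplified]
  show ?thesis by simp
qed

private lemma [simp]: "good 28"
proof -
  note [simp] = cyc_dist_table[of 28, simplified]
  note [simp] = cyc_edge_dist_table[of 28, simplified]
  show ?thesis by simp
qed

private lemma [simp]: "good 29"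
proof -
  note [simp] = cyc_dist_table[of 29, simplified]
  note [simp] = cyc_edge_dist_table[of 29, simplified]
  show ?thesis by simp
qed

private lemma [simp]: "good 30"
proof -
  note [simp] = cyc_dist_table[of 30, simplified]
  note [simp] = cyc_edge_dist_table[of 30, simplified]
  show ?thesis by simp
qed

private lemma [simp]: "good 31"
proof -
  note [simp] = cyc_dist_table[of 31, simplified]
  note [simp] = cyc_edge_dist_table[of 31, simplified]
  show ?thesis by simp
qed

private lemma [simp]: "good 32"
proof -
  note [simp] = cyc_dist_table[of 32, simplified]
  note [simp] = cyc_edge_dist_table[of 32, simplified]
  show ?thesis by simp
qed

private lemma [simp]: "good 33"
proof -
  note [simp] = cyc_dist_table[of 33, simplified]
  note [simp] = cyc_edge_dist_table[of 33, simplified]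
  show ?thesis by simp
qed

private lemma [simp]: "good 34"
proof -
  note [simp] = cyc_dist_table[of 34, simplified]
  note [simp] = cyc_edge_dist_table[of 34, simplified]
  show ?thesis by simp
qed

private lemma [simp]: "good 35"
proof -
  note [simp] = cyc_dist_table[of 35, simplified]
  note [simp] = cyc_edge_dist_table[of 35, simplified]
  show ?thesis by simp
qed

private lemma [simp]: "good 36"
proof -
  note [simp] = cyc_dist_table[of 36, simplified]
  note [simp] = cyc_edge_dist_table[of 36, simplified]
  show ?thesis by simp
qed

private lemma [simp]: "good 37"
proof -
  note [simp] = cyc_dist_table[of 37, simplified]
  note [simp] = cyc_edge_dist_table[of 37, simplified]
  show ?thesis by simp
qed

private lemma [simp]: "good 38"
proof -
  note [simp] = cyc_dist_table[of 38, simplified]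
  note [simp] = cyc_edge_dist_table[of 38, simplified]
  show ?thesis by simp
qed

private lemma [simp]: "good 39"
proof -
  note [simp] = cyc_dist_table[of 39, simplified]
  note [simp] = cyc_edge_dist_table[of 39, simplified]
  show ?thesis by simp
qed

private lemma [simp]: "good 40"
proof -
  note [simp] = cyc_dist_table[of 40, simplified]
  note [simp] = cyc_edge_dist_table[of 40, simplified]
  show ?thesis by simp
qed

private lemma [simp]: "good 41"
proof -
  note [simp] = cyc_dist_table[of 41, simplified]
  note [simp] = cyc_edge_dist_table[of 41, simplified]
  show ?thesis by simp
qed

private lemma [simp]: "good 42"
proof -
  note [simp] = cyc_dist_table[of 42, simplified]
  note [simp] = cyc_edge_dist_table[of 42, simplified]
  show ?thesis by simp
qed

private lemma [simp]: "good 43"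
proof -
  note [simp] = cyc_dist_table[of 43, simplified]
  note [simp] = cyc_edge_dist_table[of 43, simplified]
  show ?thesis by simp
qed

private lemma [simp]: "good 44"
proof -
  note [simp] = cyc_dist_table[of 44, simplified]
  note [simp] = cyc_edge_dist_table[of 44, simplified]
  show ?thesis by simp
qed

private lemma [simp]: "good 45"
proof -
  note [simp] = cyc_dist_table[of 45, simplified]
  note [simp] = cyc_edge_dist_table[of 45, simplified]
  show ?thesis by simp
qed

private lemma [simp]: "good 46"
proof -
  note [simp] = cyc_dist_table[of 46, simplified]
  note [simp] = cyc_edge_dist_table[of 46, simplified]
  show ?thesis by simp
qed

private lemma [simp]: "good 47"
proof -
  note [simp] = cyc_dist_table[of 47, simplified]
  note [simp] = cyc_edge_dist_table[of 47, simplified]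
  show ?thesis by simp
qed

private lemma [simp]: "good 48"
proof -
  note [simp] = cyc_dist_table[of 48, simplified]
  note [simp] = cyc_edge_dist_table[of 48, simplified]
  show ?thesis by simp
qed

private lemma [simp]: "good 49"
proof -
  note [simp] = cyc_dist_table[of 49, simplified]
  note [simp] = cyc_edge_dist_table[of 49, simplified]
  show ?thesis by simp
qed

private lemma [simp]: "good 50"
proof -
  note [simp] = cyc_dist_table[of 50, simplified]
  note [simp] = cyc_edge_dist_table[of 50, simplified]
  show ?thesis by simp
qed

private lemma [simp]: "good 51"
proof -
  note [simp] = cyc_dist_table[of 51, simplified]
  note [simp] = cyc_edge_dist_table[of 51, simplified]
  show ?thesis by simp
qed

private lemma [simp]: "good 52"
proof -
  note [simp] = cyc_dist_table[of 52, simplified]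
  note [simp] = cyc_edge_dist_table[of 52, simplified]
  show ?thesis by simp
qed

private lemma [simp]: "good 53"
proof -
  note [simp] = cyc_dist_table[of 53, simplified]
  note [simp] = cyc_edge_dist_table[of 53, simplified]
  show ?thesis by simp
qed

private lemma [simp]: "good 54"
proof -
  note [simp] = cyc_dist_table[of 54, simplified]
  note [simp] = cyc_edge_dist_table[of 54, simplified]
  show ?thesis by simp
qed

private lemma [simp]: "good 55"
proof -
  note [simp] = cyc_dist_table[of 55, simplified]
  note [simp] = cyc_edge_dist_table[of 55, simplified]
  show ?thesis by simp
qed

end

section \<open>Induction in steps of 6 and conclusion\<close>

lemma good_small:
  assumes "11 \<le> n" "n < 56"
  shows "good n"
proof -
  have "list_all good [11..55]" by simp
  then show ?thesis using assms by (simp add: list_all_iff del: upto_rec_numeral)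
qed

lemma good_all:
  assumes "11 \<le> n"
  shows "unresolvable True True pairs_UUU n" "unresolvable True False pairs_UVV n"
    "unresolvable False True pairs_VUU n" "unresolvable False False pairs_VVV n"
proof -
  let ?Q = "\<lambda>n. unresolvable True True pairs_UUU n \<and> unresolvable True False pairs_UVV n \<and>
    unresolvable False True pairs_VUU n \<and> unresolvable False False pairs_VVV n"
  have "?Q n" using assms
  proof (induction "nat n" arbitrary: n rule: less_induct)
    case less
    show ?case
    proof (cases "n < 56")
      case True
      then have "good n" using good_small less.prems by simp
      then show ?thesis using less.prems by (auto simp only: good_def intro!: check_unresolvable)
    next
      case False
      \<comment> \<open>The descent enters the checked range between 50 and 55, so
        \<open>n - 6\<close> never falls below 11.\<close>
      then have "?Q (n - 6)" using less.hyps[of "n - 6"] by simp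
      then show ?thesis using False by (auto intro!: unresolvable_step pairs_admissible)
    qed
  qed
  then show "unresolvable True True pairs_UUU n" "unresolvable True False pairs_UVV n"
    "unresolvable False True pairs_VUU n" "unresolvable False False pairs_VVV n" by blast+
qed

theorem proposition2p2:
  fixes n :: nat
  assumes "n \<ge> 11"
  shows "\<not> (\<exists>R. edge_resolving_set (gen_petersen n 3) R \<and> card R = 3)"
proof
  assume "\<exists>R. edge_resolving_set (gen_petersen n 3) R \<and> card R = 3"
  then obtain x y z where R: "edge_resolving_set (gen_petersen n 3) {x, y, z}"
    by (auto simp: card_3_iff)
  then have v: "x \<in> verts (gen_petersen n 3)" "y \<in> verts (gen_petersen n 3)"
      "z \<in> verts (gen_petersen n 3)"
    by (simp_all add: edge_resolving_set_def)
  obtain K s where x: "x = vert n K s" using v(1) by (rule vert_cases)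
  obtain L t where y: "y = vert n L t" using v(2) by (rule vert_cases)
  obtain M u where z: "z = vert n M u" using v(3) by (rule vert_cases)
  have "\<exists>P. unresolvable K L P (int n) \<and> list_all admissible P" for K L
    using good_all[of "int n"] pairs_admissible assms by (cases K; cases L) auto
  then have no: "\<not> edge_resolving_set (gen_petersen n 3) {vert n K s, vert n L t, vert n L u}"
    for K L s t u
    using not_resolved[OF assms] by blast
  consider "L = M" | "K = M" | "K = L" by blast
  then show False
  proof cases
    case 1
    then show ?thesis using R no[of K s L t u] by (simp add: x y z)
  next
    case 2
    then show ?thesis using R no[of L t K s u] by (simp add: x y z insert_commute)
  next
    case 3
    then show ?thesis using R no[of M u K s t] by (simp add: x y z insert_commute)
  qed
qed

end
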